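(* Let $w$ be a Dyck word in the alphabet $\{x,D\}$. For all integers $k \geq 0$, $$S_w(k) = {H_w \brace k}.$$
   Context: Stirling numbers of a word. View $x$ as the operator of multiplication by the variable $x$ and $D$ as differentiation with respect to $x$, acting on infinitely differentiable functions (say on $(0,\infty)$); a word in $\{x,D\}$ is read as the composition of these operators (so $Dx = xD+1$). For every word $w$ with $m$ $x$'s and $n$ $D$'s there is a unique sequence of integers $(S_w(k))_{k\ge 0}$ (only finitely many nonzero) with $$w = x^{m-n}\sum_{k\ge 0} S_w(k)\, x^k D^k .$$ Dyck words. A word in $\{x,D\}$ is a Dyck word if it has the same number of $x$'s as $D$'s and every initial segment (reading left to right) has at least as many $x$'s as $D$'s. To a Dyck word $w$ corresponds a Dyck path in $\mathbb{R}^2$: a staircase path starting at $(0,0)$ which, reading $w$ from left to right, takes a unit step in the positive $y$ direction for each $x$ and a unit step in the positive $x$ direction for each $D$; it ends on the line $x=y$ and never goes below it. The graph $H_w$. Label each unit square of the integer grid by the coordinates of its top-right corner (so the square $[i-1,i]\times[j-1,j]$ has label $(i,j)$). For a Dyck word $w$ with $n$ $x$'s, let $\mathcal{W}_w$ be the set of labels of unit squares that lie below the Dyck path of $w$ and completely above the line $x=y$ (i.e. whose interior lies strictly above this line, so $i<j$). The graph $H_w$ has vertex set $\{1,\ldots,n\}$, with an edge between $i$ and $j$ ($i<j$) if and only if $(i,j)\in\mathcal{W}_w$. Graph Stirling numbers. For a graph $G$ and an integer $k\ge0$, ${G\brace k}$ is the number of partitions of the vertex set of $G$ into $k$ non-empty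 classes, none of which contains both endvertices of an edge of $G$. *)

theory Defs
  imports "HOL-Analysis.Analysis" "HOL-Library.Disjoint_Sets"
begin

datatype letter = LX | LD

type_synonym word = "letter list"

fun letter_op :: "letter \<Rightarrow> (real \<Rightarrow> real) \<Rightarrow> real \<Rightarrow> real" where
  "letter_op LX f = (\<lambda>t. t * f t)"
| "letter_op LD f = deriv f"

text \<open>Composition of operators: the rightmost letter acts first.\<close>

definition word_op :: "word \<Rightarrow> (real \<Rightarrow> real) \<Rightarrow> real \<Rightarrow> real" where
  "word_op w = foldr (\<lambda>a F. letter_op a \<circ> F) w id"

text \<open>
  Functions on \<open>(0, \<infinity>)\<close> are represented by total functions whose values
  outside \<open>(0, \<infinity>)\<close> are arbitrary; as \<open>(0, \<infinity>)\<close> is open, these values do not affect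
  the derivatives at positive points.
\<close>

definition smooth_on_pos :: "(real \<Rightarrow> real) \<Rightarrow> bool" where
  "smooth_on_pos f \<longleftrightarrow> (\<forall>k. \<forall>t>0. ((deriv ^^ k) f) field_differentiable (at t))"

definition normal_order_coeffs :: "word \<Rightarrow> (nat \<Rightarrow> int) \<Rightarrow> bool" where
  "normal_order_coeffs w S \<longleftrightarrow>
     finite {k. S k \<noteq> 0} \<and>
     (\<forall>f. smooth_on_pos f \<longrightarrow>
       (\<forall>t>0. word_op w f t =
          t powi (int (count_list w LX) - int (count_list w LD)) *
          (\<Sum>k | S k \<noteq> 0. of_int (S k) * (t ^ k * (deriv ^^ k) f t))))"

definition word_stirling :: "word \<Rightarrow> nat \<Rightarrow> int" where
  "word_stirling w = (THE S. normal_order_coeffs w S)"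

definition dyck_word :: "word \<Rightarrow> bool" where
  "dyck_word w \<longleftrightarrow>
     count_list w LX = count_list w LD \<and>
     (\<forall>p\<le>length w. count_list (take p w) LD \<le> count_list (take p w) LX)"

text \<open>The point reached after the first \<open>p\<close> letters: \<open>LX\<close> is a step up, \<open>LD\<close> a step to the right.\<close>

definition path_point :: "word \<Rightarrow> nat \<Rightarrow> real \<times> real" where
  "path_point w p = (real (count_list (take p w) LD), real (count_list (take p w) LX))"

definition dyck_path :: "word \<Rightarrow> (real \<times> real) set" where
  "dyck_path w = (\<Union>p<length w. closed_segment (path_point w p) (path_point w (Suc p)))"

definition below_path :: "word \<Rightarrow> (real \<times> real) set" where
  "below_path w = {(a, b). \<exists>b'\<ge>b. (a, b') \<in> dyck_path w}"

definition unit_square :: "nat \<Rightarrow> nat \<Rightarrow> (real \<times> real) set" where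
  "unit_square i j = {real i - 1..real i} \<times> {real j - 1..real j}"

text \<open>
  Natural-number labels suffice: no square with a nonpositive first coordinate lies below
  the path, since the path has no point with negative abscissa, and then \<open>j > i\<close> is positive too.
\<close>

definition dyck_squares :: "word \<Rightarrow> (nat \<times> nat) set" where
  "dyck_squares w =
     {(i, j). unit_square i j \<subseteq> below_path w \<and>
              interior (unit_square i j) \<subseteq> {(a, b). a < b}}"

text \<open>A graph is a pair of a vertex set and a set of edges, each edge being the set of its endvertices.\<close>

type_synonym 'a graph = "'a set \<times> 'a set set"

definition dyck_graph :: "word \<Rightarrow> nat graph" where
  "dyck_graph w =
     (let n = count_list w LX in
       ({1..n}, {{i, j} | i j. i \<in> {1..n} \<and> j \<in> {1..n} \<and> i < j \<and> (i, j) \<in> dyck_squares w}))"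

definition graph_stirling :: "'a graph \<Rightarrow> nat \<Rightarrow> nat" where
  "graph_stirling G k =
     card {P. partition_on (fst G) P \<and> card P = k \<and> (\<forall>C\<in>P. \<forall>e\<in>snd G. \<not> e \<subseteq> C)}"

end

theory Submission
  imports Defs
begin

text \<open>
  Both sides obey the same recursion when a word is built up from right to left.

  On the analytic side, let \<open>e\<close> be the number of \<open>x\<close>'s minus the number of \<open>D\<close>'s in a word
  \<open>v\<close>, and suppose \<open>v = x\<^sup>e \<Sum> c\<^sub>k x\<^sup>k D\<^sup>k\<close>. Multiplying by \<open>x\<close> on the left keeps the
  coefficients, while \<open>D x\<^bsup>e+k\<^esup> D\<^sup>k = (e + k) x\<^bsup>e+k-1\<^esup> D\<^sup>k + x\<^bsup>e+k\<^esup> D\<^bsup>k+1\<^esup>\<close> shows that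
  the \<open>k\<close>-th coefficient of \<open>D v\<close> is \<open>(e + k) c\<^sub>k + c\<^bsub>k-1\<^esub>\<close>. This recursion defines
  \<open>normal_coeff\<close>. Testing on \<open>f(t) = (t - 1)\<^sup>r\<close> at \<open>t = 1\<close> isolates the \<open>r\<close>-th coefficient, so
  the coefficients are unique and \<open>word_stirling = normal_coeff\<close>.

  On the combinatorial side, let \<open>h\<close> be the number of \<open>x\<close>'s before the \<open>i\<close>-th \<open>D\<close> of a Dyck
  word. The square \<open>(i, j)\<close> with \<open>i < j\<close> lies below the path iff \<open>j \<le> h\<close>
  (\<open>dyck_squares_iff\<close>). So the neighbours of \<open>i\<close> beyond \<open>i\<close> are \<open>i + 1, \<dots>, h\<close>, and since the
  path never descends, they form a clique (\<open>dyck_squares_below\<close>). A stable partition of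
  \<open>{i, \<dots>, n}\<close> either has \<open>{i}\<close> as a class, or arises from a stable partition of
  \<open>{i + 1, \<dots>, n}\<close> by putting \<open>i\<close> into a class that contains none of these neighbours. As the
  \<open>h - i\<close> neighbours lie in pairwise different classes, exactly \<open>k - (h - i)\<close> of the \<open>k\<close> classes
  are available (\<open>graph_stirling_simplicial_vertex\<close>). Finally \<open>i - h\<close> is precisely the excess
  \<open>e\<close> of the suffix after the \<open>i\<close>-th \<open>D\<close>, because the whole word is balanced.
  Hence the two recursions coincide: the coefficients of a suffix of \<open>w\<close> count the stable
  partitions of the subgraph induced on the indices of the \<open>D\<close>'s that occur in it.
\<close>

section \<open>Normal ordering of words\<close>

definition excess :: "word \<Rightarrow> int" where
  "excess w = int (count_list w LX) - int (count_list w LD)"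

fun normal_coeff :: "word \<Rightarrow> nat \<Rightarrow> int" where
  "normal_coeff [] k = (if k = 0 then 1 else 0)"
| "normal_coeff (LX # w) k = normal_coeff w k"
| "normal_coeff (LD # w) k =
     (int k + excess w) * normal_coeff w k + (if k = 0 then 0 else normal_coeff w (k - 1))"

lemma normal_coeff_eq_0: "length w < k \<Longrightarrow> normal_coeff w k = 0"
  by (induction w k rule: normal_coeff.induct) auto

lemma excess_simps [simp]:
  "excess [] = 0" "excess (LX # w) = excess w + 1" "excess (LD # w) = excess w - 1"
  by (auto simp: excess_def)

lemma word_op_simps [simp]:
  "word_op [] f = f" "word_op (a # w) f = letter_op a (word_op w f)"
  by (auto simp: word_op_def)

text \<open>
  The normal form is proved for arbitrary words, not only Dyck words, since the induction passes
  through all suffixes; there the excess may be negative, whence the integer powers.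
\<close>

lemma word_op_normal_order:
  assumes f: "smooth_on_pos f" and "t > 0"
  shows "word_op w f t =
    t powi excess w * (\<Sum>k\<le>length w. of_int (normal_coeff w k) * (t ^ k * (deriv ^^ k) f t))"
  using \<open>t > 0\<close>
proof (induction w arbitrary: t)
  case Nil
  then show ?case by simp
next
  case (Cons a w)
  let ?c = "\<lambda>k. real_of_int (normal_coeff w k)" and ?e = "excess w" and ?n = "length w"
  let ?F = "\<lambda>k. (deriv ^^ k) f"
  show ?case
  proof (cases a)
    case LX
    have "(\<Sum>k\<le>Suc ?n. ?c k * (t ^ k * ?F k t)) = (\<Sum>k\<le>?n. ?c k * (t ^ k * ?F k t))"
      by (simp add: normal_coeff_eq_0)
    with LX Cons show ?thesis
      by (simp add: power_int_add_1' del: sum.atMost_Suc)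
  next
    case LD
    let ?G = "\<lambda>k. ?c k * (t ^ k * ?F k t)"
    let ?X = "\<Sum>k\<le>?n. ?c k * (of_int (int k + ?e) * (t ^ k * ?F k t) + t ^ Suc k * ?F (Suc k) t)"
    \<comment> \<open>Absorb the prefactor into the sum, so that each summand is differentiated as a product.\<close>
    have "((\<lambda>s. \<Sum>k\<le>?n. ?c k * (s powi (?e + int k) * ?F k s)) has_field_derivative
        (\<Sum>k\<le>?n. ?c k * (of_int (?e + int k) * t powi (?e + int k - 1) * ?F k t +
                        t powi (?e + int k) * ?F (Suc k) t))) (at t)"
    proof (rule DERIV_sum)
      fix k
      have "(?F k has_field_derivative ?F (Suc k) t) (at t)"
        using f Cons.prems
        by (auto simp: smooth_on_pos_def field_differentiable_derivI)
      then show "((\<lambda>s. ?c k * (s powi (?e + int k) * ?F k s)) has_field_derivative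
          ?c k * (of_int (?e + int k) * t powi (?e + int k - 1) * ?F k t +
                  t powi (?e + int k) * ?F (Suc k) t)) (at t)"
        using Cons.prems
        by (auto intro!: derivative_eq_intros simp: algebra_simps)
    qed
    also have "(\<Sum>k\<le>?n. ?c k * (of_int (?e + int k) * t powi (?e + int k - 1) * ?F k t +
                        t powi (?e + int k) * ?F (Suc k) t)) = t powi (?e - 1) * ?X"
      unfolding sum_distrib_left
      using Cons.prems
      by (intro sum.cong refl) (simp add: power_int_add power_int_diff field_simps)
    \<comment> \<open>The induction hypothesis holds on the open half-line, hence near \<open>t\<close>.\<close>
    finally have "(word_op w f has_field_derivative t powi (?e - 1) * ?X) (at t)"
    proof (rule has_field_derivative_transform_within_open[of _ _ _ "{0<..}"])
      fix s :: real assume "s \<in> {0<..}"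
      then show "(\<Sum>k\<le>?n. ?c k * (s powi (?e + int k) * ?F k s)) = word_op w f s"
        using Cons.IH[of s]
        by (auto simp: sum_distrib_left power_int_add algebra_simps intro!: sum.cong)
    qed (use Cons.prems in auto)
    then have "word_op (a # w) f t = t powi (?e - 1) * ?X"
      using LD by (simp add: DERIV_imp_deriv)
    also have "?X = (\<Sum>k\<le>?n. of_int (int k + ?e) * ?G k) + (\<Sum>k\<le>?n. ?c k * (t ^ Suc k * ?F (Suc k) t))"
      by (simp add: sum.distrib[symmetric] algebra_simps)
    also have "(\<Sum>k\<le>?n. of_int (int k + ?e) * ?G k) = (\<Sum>k\<le>Suc ?n. of_int (int k + ?e) * ?G k)"
      by (simp add: normal_coeff_eq_0)
    also have "(\<Sum>k\<le>?n. ?c k * (t ^ Suc k * ?F (Suc k) t)) =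
        (\<Sum>k\<le>Suc ?n. of_int (if k = 0 then 0 else normal_coeff w (k - 1)) * (t ^ k * ?F k t))"
      by (subst sum.atMost_Suc_shift) simp
    finally show ?thesis
      using LD by (simp add: sum.distrib[symmetric] algebra_simps del: sum.atMost_Suc)
  qed
qed

lemma normal_order_coeffs_normal_coeff: "normal_order_coeffs w (normal_coeff w)"
proof -
  have sub: "{k. normal_coeff w k \<noteq> 0} \<subseteq> {..length w}"
    using normal_coeff_eq_0[of w] by (metis (mono_tags) atMost_iff mem_Collect_eq not_le subsetI)
  have "(\<Sum>k | normal_coeff w k \<noteq> 0. of_int (normal_coeff w k) * (t ^ k * (deriv ^^ k) f t)) =
        (\<Sum>k\<le>length w. of_int (normal_coeff w k) * (t ^ k * (deriv ^^ k) f t))" for f and t :: real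
    using sub by (intro sum.mono_neutral_left) auto
  then show ?thesis
    using finite_subset[OF sub] word_op_normal_order[of _ _ w]
    by (simp add: normal_order_coeffs_def excess_def)
qed

text \<open>
  For \<open>k > r\<close> the exponent \<open>r - k\<close> is truncated to \<open>0\<close>, but then the product contains the
  factor \<open>real r - real r\<close>, so the formula covers the vanishing derivatives as well.
\<close>

lemma higher_deriv_shifted_power:
  "(deriv ^^ k) (\<lambda>t::real. (t - a) ^ r) = (\<lambda>t. (\<Prod>i<k. real r - real i) * (t - a) ^ (r - k))"
proof (induction k)
  case (Suc k)
  have "((\<lambda>t. (\<Prod>i<k. real r - real i) * (t - a) ^ (r - k)) has_field_derivative
      (\<Prod>i<Suc k. real r - real i) * (t - a) ^ (r - Suc k)) (at t)" for t
  proof (cases "k \<le> r")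
    case True
    then show ?thesis
      by (auto intro!: derivative_eq_intros simp: of_nat_diff)
  next
    case False
    then have "(\<Prod>i<k. real r - real i) = 0" "(\<Prod>i<Suc k. real r - real i) = 0"
      by auto
    then show ?thesis
      by (simp only: mult_zero_left DERIV_const)
  qed
  from DERIV_imp_deriv[OF this] show ?case
    by (simp only: funpow.simps o_apply Suc.IH)
qed simp

text \<open>
  At \<open>t = 1\<close> the only derivative of \<open>(t - 1)\<^sup>r\<close> that does not vanish is the \<open>r\<close>-th, and the
  prefactor is \<open>1\<close> there; so the value of the operator at this point determines the \<open>r\<close>-th
  coefficient.
\<close>

lemma normal_order_coeffs_unique:
  assumes "normal_order_coeffs w S" "normal_order_coeffs w T"
  shows "S = T"
proof
  fix r
  define f where "f = (\<lambda>t::real. (t - 1) ^ r)"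
  define C where "C = (\<Prod>i<r. real r - real i)"
  have "C \<noteq> 0"
    by (auto simp: C_def)
  have f: "smooth_on_pos f"
    unfolding smooth_on_pos_def f_def higher_deriv_shifted_power
    by (auto intro!: derivative_intros)
  have deriv_f: "(deriv ^^ k) f 1 = (if k = r then C else 0)" for k
    by (auto simp: f_def C_def higher_deriv_shifted_power power_0_left)
  have "word_op w f 1 = of_int (U r) * C" if "normal_order_coeffs w U" for U
  proof -
    have "word_op w f 1 = (\<Sum>k | U k \<noteq> 0. of_int (U k) * (deriv ^^ k) f 1)"
      using that f by (simp add: normal_order_coeffs_def)
    also have "\<dots> = of_int (U r) * C"
      using that by (simp add: deriv_f normal_order_coeffs_def if_distrib cong: if_cong)
    finally show ?thesis .
  qed
  from this[OF assms(1)] this[OF assms(2)] show "S r = T r"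
    using \<open>C \<noteq> 0\<close> by simp
qed

lemma word_stirling_eq_normal_coeff: "word_stirling w = normal_coeff w"
  unfolding word_stirling_def
  using normal_order_coeffs_normal_coeff normal_order_coeffs_unique by blast

section \<open>Stable partitions and simplicial vertices\<close>

text \<open>
  Edges that are not contained in the vertex set impose no condition. The subgraph of \<open>(V, E)\<close>
  induced on \<open>U \<subseteq> V\<close> can therefore be represented by \<open>(U, E)\<close>, with the same edge set.
\<close>

definition stable_partitions :: "'a graph \<Rightarrow> nat \<Rightarrow> 'a set set set" where
  "stable_partitions G k =
     {P. partition_on (fst G) P \<and> card P = k \<and> (\<forall>C\<in>P. \<forall>e\<in>snd G. \<not> e \<subseteq> C)}"

lemma finite_stable_partitions: "finite (fst G) \<Longrightarrow> finite (stable_partitions G k)"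
  unfolding stable_partitions_def
  by (rule finite_subset[OF _ finitely_many_partition_on[of "fst G"]]) auto

lemma graph_stirling_empty: "graph_stirling ({}, E) k = (if k = 0 then 1 else 0)"
proof -
  have "{P. partition_on {} P \<and> card P = k \<and> (\<forall>C\<in>P. \<forall>e\<in>E. \<not> e \<subseteq> C)} = (if k = 0 then {{}} else {})"
    by (auto simp: partition_on_empty)
  then show ?thesis by (simp add: graph_stirling_def)
qed

lemma disjnt_other_classes:
  assumes "partition_on A P" "B \<in> P"
  shows "disjnt B (\<Union>(P - {B}))"
proof -
  have "disjnt B C" if "C \<in> P - {B}" for C
    using assms that by (metis DiffD1 DiffD2 insertI1 pairwiseD partition_onD2)
  then show ?thesis
    by (auto simp: disjnt_iff)
qed

text \<open>
  Two adjacent vertices never share a class, so sending each vertex of the clique to its class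
  is a bijection from \<open>N\<close> onto the classes that meet \<open>N\<close>.
\<close>

lemma card_classes_avoiding_clique:
  assumes P: "P \<in> stable_partitions (V, E) k" and V: "finite V" and "N \<subseteq> V"
    and clique: "\<And>a b. a \<in> N \<Longrightarrow> b \<in> N \<Longrightarrow> a \<noteq> b \<Longrightarrow> {a, b} \<in> E"
  shows "int (card {C \<in> P. C \<inter> N = {}}) = int k - int (card N)"
proof -
  have part: "partition_on V P" and k: "card P = k"
    and stable: "\<And>C e. C \<in> P \<Longrightarrow> e \<in> E \<Longrightarrow> \<not> e \<subseteq> C"
    using P by (auto simp: stable_partitions_def)
  have fin: "finite P"
    using V part by (rule finite_elements)
  have ex: "\<exists>C. C \<in> P \<and> a \<in> C" if "a \<in> N" for a
    using that \<open>N \<subseteq> V\<close> part by (auto simp: partition_on_def)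
  then obtain cl where cl: "\<And>a. a \<in> N \<Longrightarrow> cl a \<in> P \<and> a \<in> cl a"
    by metis
  have "bij_betw cl N {C \<in> P. C \<inter> N \<noteq> {}}"
  proof (rule bij_betw_imageI)
    show "inj_on cl N"
    proof (rule inj_onI, rule ccontr)
      fix a b assume "a \<in> N" "b \<in> N" "cl a = cl b" "a \<noteq> b"
      then show False
        using stable[of "cl a" "{a, b}"] cl[of a] cl[of b] clique[of a b] by auto
    qed
    have "C = cl a" if "C \<in> P" "a \<in> C" "a \<in> N" for C a
      using part cl[of a] that unfolding partition_on_def disjoint_def by blast
    then show "cl ` N = {C \<in> P. C \<inter> N \<noteq> {}}"
      using cl by blast
  qed
  then have "card N = card {C \<in> P. C \<inter> N \<noteq> {}}"
    by (rule bij_betw_same_card)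
  moreover have "card P = card {C \<in> P. C \<inter> N = {}} + card {C \<in> P. C \<inter> N \<noteq> {}}"
    using fin by (subst card_Un_disjoint[symmetric]) (auto intro!: arg_cong[where f = card])
  ultimately show ?thesis using k by simp
qed

text \<open>
  Adding a vertex \<open>v\<close> whose neighbourhood \<open>N\<close> is a clique: the second summand counts the
  partitions in which \<open>{v}\<close> is a class, the first those in which \<open>v\<close> joins a class of a
  stable partition of \<open>V\<close> that avoids \<open>N\<close>. The coefficient is stated over the integers. When it
  is negative there is no stable partition of \<open>V\<close> into \<open>k\<close> classes, as the clique \<open>N\<close> would
  need more than \<open>k\<close> of them, so the summand vanishes.
\<close>

lemma graph_stirling_simplicial_vertex:
  assumes V: "finite V" and v: "v \<notin> V"
    and edges: "\<And>e. e \<in> E \<Longrightarrow> \<exists>a b. a \<noteq> b \<and> e = {a, b}"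
    and N: "N = {u \<in> V. {u, v} \<in> E}"
    and clique: "\<And>a b. a \<in> N \<Longrightarrow> b \<in> N \<Longrightarrow> a \<noteq> b \<Longrightarrow> {a, b} \<in> E"
  shows "int (graph_stirling (insert v V, E) k) =
    (int k - int (card N)) * int (graph_stirling (V, E) k) +
    (if k = 0 then 0 else int (graph_stirling (V, E) (k - 1)))"
proof -
  let ?A = "stable_partitions (insert v V, E) k"
  let ?B = "stable_partitions (V, E)"
  let ?join = "\<lambda>(Q, C). insert (insert v C) (Q - {C})"
  let ?J = "SIGMA Q:?B k. {C \<in> Q. C \<inter> N = {}}"
  have gs: "graph_stirling G j = card (stable_partitions G j)" for G :: "'a graph" and j
    by (simp add: graph_stirling_def stable_partitions_def)
  have fin: "finite P" if "partition_on W P" "finite W" for P and W :: "'a set"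
    using that by (metis finite_elements)
  have stable_iff: "(\<forall>e\<in>E. \<not> e \<subseteq> insert v C) \<longleftrightarrow> (\<forall>e\<in>E. \<not> e \<subseteq> C) \<and> C \<inter> N = {}"
    if "C \<subseteq> V" for C
  proof
    assume *: "\<forall>e\<in>E. \<not> e \<subseteq> insert v C"
    then have "\<not> (u \<in> C \<and> {u, v} \<in> E)" for u
      by auto
    with * N show "(\<forall>e\<in>E. \<not> e \<subseteq> C) \<and> C \<inter> N = {}"
      by auto
  next
    assume *: "(\<forall>e\<in>E. \<not> e \<subseteq> C) \<and> C \<inter> N = {}"
    show "\<forall>e\<in>E. \<not> e \<subseteq> insert v C"
    proof (intro ballI notI)
      fix e assume "e \<in> E" "e \<subseteq> insert v C"
      moreover obtain a b where "a \<noteq> b" "e = {a, b}"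
        using edges \<open>e \<in> E\<close> by blast
      ultimately have "(\<exists>u\<in>C. e = {u, v}) \<or> e \<subseteq> C"
        by auto
      then show False
        using * that \<open>e \<in> E\<close> N by auto
    qed
  qed
  \<comment> \<open>Partitions with the class \<open>{v}\<close>: delete that class.\<close>
  have singleton: "card {P \<in> ?A. {v} \<in> P} = (if k = 0 then 0 else card (?B (k - 1)))"
  proof (cases k)
    case 0
    have "P \<notin> ?A" if "{v} \<in> P" for P
      using that 0 fin[of "insert v V" P] V by (auto simp: stable_partitions_def)
    then have "{P \<in> ?A. {v} \<in> P} = {}"
      by blast
    then have "card {P \<in> ?A. {v} \<in> P} = 0"
      by (simp only: card.empty)
    with 0 show ?thesis by simp
  next
    case (Suc m)
    have "bij_betw (insert {v}) (?B m) {P \<in> ?A. {v} \<in> P}"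
    proof (rule bij_betw_byWitness[where f' = "\<lambda>P. P - {{v}}"])
      have nin: "{v} \<notin> Q" "disjnt {v} (\<Union>Q)" if "Q \<in> ?B m" for Q
        using that v by (auto simp: stable_partitions_def partition_on_def)
      show "\<forall>Q\<in>?B m. insert {v} Q - {{v}} = Q"
        using nin by blast
      show "insert {v} ` ?B m \<subseteq> {P \<in> ?A. {v} \<in> P}"
      proof (rule image_subsetI)
        fix Q assume Q: "Q \<in> ?B m"
        have "partition_on (insert v V) (insert {v} Q)"
          using Q v nin[OF Q] by (subst partition_on_insert) (auto simp: stable_partitions_def)
        moreover have "card (insert {v} Q) = k"
          using Q nin[OF Q] fin[of V Q] V Suc by (auto simp: stable_partitions_def)
        moreover have "\<not> e \<subseteq> {v}" if "e \<in> E" for e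
          using edges[OF that] by auto
        ultimately show "insert {v} Q \<in> {P \<in> ?A. {v} \<in> P}"
          using Q by (auto simp: stable_partitions_def)
      qed
      show "(\<lambda>P. P - {{v}}) ` {P \<in> ?A. {v} \<in> P} \<subseteq> ?B m"
      proof (rule image_subsetI)
        fix P assume P: "P \<in> {P \<in> ?A. {v} \<in> P}"
        then have part: "partition_on (insert v V) P" and "{v} \<in> P" "card P = Suc m"
          using Suc by (auto simp: stable_partitions_def)
        then have dj: "disjnt {v} (\<Union>(P - {{v}}))"
          using disjnt_other_classes by metis
        have "insert {v} (P - {{v}}) = P"
          using \<open>{v} \<in> P\<close> by blast
        then have "partition_on (insert v V - {v}) (P - {{v}})"
          using part partition_on_insert[OF dj, of "insert v V"] by simp
        moreover have "insert v V - {v} = V"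
          using v by blast
        ultimately show "P - {{v}} \<in> ?B m"
          using P \<open>{v} \<in> P\<close> \<open>card P = Suc m\<close> by (auto simp: stable_partitions_def)
      qed
    qed auto
    then show ?thesis
      using Suc by (simp add: bij_betw_same_card)
  qed
  \<comment> \<open>With the other classes \<open>R\<close> held fixed, \<open>v\<close> may be added to or removed from the class \<open>C\<close>.\<close>
  have move_v: "insert (insert v C) R \<in> ?A \<longleftrightarrow> insert C R \<in> ?B k \<and> C \<inter> N = {}"
    if "C \<subseteq> V" "C \<noteq> {}" "disjnt (insert v C) (\<Union>R)" for C R
  proof -
    have "disjnt C (\<Union>R)"
      using that(3) by (simp add: disjnt_def)
    moreover have "insert v V - insert v C = V - C"
      using v by blast
    ultimately have part: "partition_on (insert v V) (insert (insert v C) R) \<longleftrightarrow> partition_on V (insert C R)"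
      using that by (auto simp: partition_on_insert)
    have "C \<notin> R" "insert v C \<notin> R"
      using that by (auto simp: disjnt_def)
    moreover have "finite R" if "partition_on V (insert C R)"
      using fin[OF that V] by simp
    ultimately show ?thesis
      using part stable_iff[OF \<open>C \<subseteq> V\<close>] by (auto simp: stable_partitions_def)
  qed
  have join: "bij_betw ?join ?J {P \<in> ?A. {v} \<notin> P}"
  proof (rule bij_betw_imageI)
    have J: "C \<subseteq> V" "C \<noteq> {}" "disjnt (insert v C) (\<Union>(Q - {C}))" "insert C (Q - {C}) = Q" "v \<notin> \<Union>Q"
      if "Q \<in> ?B k" "C \<in> Q" for Q C
    proof -
      have part: "partition_on V Q"
        using that by (simp add: stable_partitions_def)
      then show "C \<subseteq> V" "C \<noteq> {}" "v \<notin> \<Union>Q" "insert C (Q - {C}) = Q"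
        using that v by (auto simp: partition_on_def)
      then show "disjnt (insert v C) (\<Union>(Q - {C}))"
        using disjnt_other_classes[OF part \<open>C \<in> Q\<close>] by (auto simp: disjnt_iff)
    qed
    show "inj_on ?join ?J"
    proof (rule inj_onI, clarify)
      fix Q C Q' C'
      assume Q: "Q \<in> ?B k" "C \<in> Q" and Q': "Q' \<in> ?B k" "C' \<in> Q'"
        and eq: "insert (insert v C) (Q - {C}) = insert (insert v C') (Q' - {C'})"
      have nin: "v \<notin> \<Union>Q" "v \<notin> \<Union>Q'"
        using J(5) Q Q' by blast+
      have "insert v C \<in> insert (insert v C') (Q' - {C'})"
        by (simp flip: eq)
      then have "insert v C = insert v C'"
        using nin by auto
      moreover have "v \<notin> C" "v \<notin> C'"
        using nin Q Q' by blast+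
      ultimately have C: "C = C'"
        by (simp add: insert_eq_iff)
      moreover have "insert v C \<notin> Q" "insert v C \<notin> Q'"
        using nin by blast+
      ultimately have "Q - {C} = Q' - {C}"
        using eq by (metis DiffD1 insert_ident)
      then show "Q = Q' \<and> C = C'"
        using C Q Q' by blast
    qed
    show "?join ` ?J = {P \<in> ?A. {v} \<notin> P}"
    proof
      show "?join ` ?J \<subseteq> {P \<in> ?A. {v} \<notin> P}"
      proof clarify
        fix Q C assume Q: "Q \<in> ?B k" "C \<in> Q" "C \<inter> N = {}"
        have "insert (insert v C) (Q - {C}) \<in> ?A"
          using move_v[OF J(1-3)[OF Q(1,2)]] J(4)[OF Q(1,2)] Q by simp
        moreover have "{v} \<notin> insert (insert v C) (Q - {C})"
          using J(2,5)[OF Q(1,2)] Q(2) by blast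
        ultimately show "insert (insert v C) (Q - {C}) \<in> ?A \<and> {v} \<notin> insert (insert v C) (Q - {C})"
          by blast
      qed
      show "{P \<in> ?A. {v} \<notin> P} \<subseteq> ?join ` ?J"
      proof clarify
        fix P assume P: "P \<in> ?A" "{v} \<notin> P"
        then have part: "partition_on (insert v V) P"
          by (simp add: stable_partitions_def)
        then obtain B where B: "B \<in> P" "v \<in> B"
          unfolding partition_on_def by blast
        define C where "C = B - {v}"
        have C: "insert v C = B" "v \<notin> C"
          using B by (auto simp: C_def)
        define R where "R = P - {B}"
        have R: "insert (insert v C) R = P"
          using B C by (auto simp: R_def)
        have "C \<noteq> {}"
          using B P C by auto
        moreover have "C \<subseteq> V"
          using partition_onD1[OF part] B(1) by (auto simp: C_def)
        moreover have dj: "disjnt (insert v C) (\<Union>R)"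
          using disjnt_other_classes[OF part B(1)] by (simp only: C R_def)
        ultimately have "insert C R \<in> ?B k \<and> C \<inter> N = {}"
          using move_v[of C R] P R by simp
        moreover have "insert C R - {C} = R"
          using dj \<open>C \<noteq> {}\<close> by (auto simp: disjnt_def)
        ultimately have in_J: "(insert C R, C) \<in> ?J" and join_eq: "?join (insert C R, C) = P"
          using R by auto
        show "P \<in> ?join ` ?J"
          by (rule rev_image_eqI[of "(insert C R, C)" ?J P ?join, OF in_J join_eq[symmetric]])
      qed
    qed
  qed
  have "card ?J = (\<Sum>Q\<in>?B k. card {C \<in> Q. C \<inter> N = {}})"
    using fin[OF _ V] finite_stable_partitions[of "(V, E)" k] V
    by (intro card_SigmaI) (auto simp: stable_partitions_def)
  also have "int \<dots> = (\<Sum>Q\<in>?B k. int k - int (card N))"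
    unfolding of_nat_sum
  proof (rule sum.cong[OF refl])
    fix Q assume "Q \<in> ?B k"
    moreover have "N \<subseteq> V"
      using N by blast
    ultimately show "int (card {C \<in> Q. C \<inter> N = {}}) = int k - int (card N)"
      using V by (intro card_classes_avoiding_clique[of Q V E k N] clique)
  qed
  finally have "int (card ?J) = (int k - int (card N)) * int (card (?B k))"
    by simp
  moreover have "card ?A = card {P \<in> ?A. {v} \<in> P} + card {P \<in> ?A. {v} \<notin> P}"
    using finite_stable_partitions[of "(insert v V, E)" k] V
    by (subst card_Un_disjoint[symmetric]) (auto intro!: arg_cong[where f = card])
  ultimately show ?thesis
    unfolding gs using bij_betw_same_card[OF join] singleton
    by (cases "k = 0") (simp_all add: algebra_simps)
qed

section \<open>The squares below a Dyck path\<close>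

lemma split_at_count:
  assumes "0 < i" "i \<le> count_list w a"
  obtains u v where "w = u @ a # v" "count_list u a = i - 1"
proof -
  have "\<exists>u v. w = u @ a # v \<and> count_list u a = i - 1"
    using assms
  proof (induction w arbitrary: i)
    case (Cons b w)
    show ?case
    proof (cases "b = a \<and> i = 1")
      case True
      then have "b # w = [] @ a # w \<and> count_list [] a = i - 1"
        by simp
      then show ?thesis by blast
    next
      case False
      let ?i = "if b = a then i - 1 else i"
      have "0 < ?i" "?i \<le> count_list w a"
        using Cons.prems False by auto
      then obtain u v where uv: "w = u @ a # v" "count_list u a = ?i - 1"
        using Cons.IH by blast
      then have "b # w = (b # u) @ a # v \<and> count_list (b # u) a = i - 1"
        using \<open>0 < ?i\<close> by auto
      then show ?thesis by blast
    qed
  qed simp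
  then show ?thesis
    using that by blast
qed

lemma count_list_take_mono: "p \<le> q \<Longrightarrow> count_list (take p w) a \<le> count_list (take q w) a"
  by (metis count_list_append le_add1 le_add_diff_inverse take_add)

text \<open>
  Over the open interval from \<open>i - 1\<close> to \<open>i\<close> the path is horizontal, at the height reached before
  the \<open>i\<close>-th \<open>D\<close>. This height decides whether column \<open>i\<close> is covered up to \<open>j\<close>.
\<close>

lemma dyck_squares_iff:
  assumes w: "w = u @ LD # v" and i: "count_list u LD = i - 1" "0 < i"
  shows "(i, j) \<in> dyck_squares w \<longleftrightarrow> i < j \<and> j \<le> count_list u LX"
proof -
  let ?h = "count_list u LX"
  have cover: "unit_square i j \<subseteq> below_path w \<longleftrightarrow> j \<le> ?h"
  proof
    assume "unit_square i j \<subseteq> below_path w"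
    \<comment> \<open>A point of the top side whose abscissa is not an integer is not below a vertical step.\<close>
    moreover have "(real i - 1/2, real j) \<in> unit_square i j"
      by (auto simp: unit_square_def)
    ultimately obtain b p where b: "real j \<le> b" and p: "p < length w"
      and seg: "(real i - 1/2, b) \<in> closed_segment (path_point w p) (path_point w (Suc p))"
      by (auto simp: below_path_def dyck_path_def)
    let ?D = "\<lambda>p. count_list (take p w) LD" and ?X = "\<lambda>p. count_list (take p w) LX"
    have Suc_p: "take (Suc p) w = take p w @ [w ! p]"
      using p by (rule take_Suc_conv_app_nth)
    have "real i - 1/2 \<in> closed_segment (real (?D p)) (real (?D (Suc p)))"
      and "b \<in> closed_segment (real (?X p)) (real (?X (Suc p)))"
      using closed_segment_PairD[OF seg[unfolded path_point_def]] by auto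
    then have a: "real (?D p) \<le> real i - 1/2" "real i - 1/2 \<le> real (?D (Suc p))"
      and b': "b \<le> real (?X (Suc p))"
      using count_list_take_mono[of p "Suc p" w] by (auto simp: closed_segment_eq_real_ivl)
    have D: "?D p < i" "i \<le> ?D (Suc p)"
      using a by linarith+
    then have "w ! p = LD"
      using Suc_p by (cases "w ! p") auto
    then have "?X (Suc p) = ?X p"
      using Suc_p by simp
    moreover have "p \<le> length u"
    proof (rule ccontr)
      assume "\<not> p \<le> length u"
      then have "?D (Suc (length u)) \<le> ?D p"
        by (intro count_list_take_mono) simp
      then show False
        using D i w by simp
    qed
    then have "?X p \<le> ?h"
      using count_list_take_mono[of p "length u" w LX] w by simp
    ultimately show "j \<le> ?h"
      using b b' by linarith
  next
    assume "j \<le> ?h"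
    show "unit_square i j \<subseteq> below_path w"
    proof (clarsimp simp: unit_square_def below_path_def)
      fix a b assume ab: "real i - 1 \<le> a" "a \<le> real i" "b \<le> real j"
      have "path_point w (length u) = (real i - 1, ?h)" "path_point w (Suc (length u)) = (real i, ?h)"
        using w i by (auto simp: path_point_def of_nat_diff)
      moreover have "(a, real ?h) = (1 - (a - (real i - 1))) *\<^sub>R (real i - 1, real ?h) +
          (a - (real i - 1)) *\<^sub>R (real i, real ?h)"
        by (simp add: algebra_simps)
      ultimately have "(a, real ?h) \<in> closed_segment (path_point w (length u)) (path_point w (Suc (length u)))"
        using ab unfolding in_segment by (intro exI[of _ "a - (real i - 1)"]) auto
      then have "(a, real ?h) \<in> dyck_path w"
        using w by (auto simp: dyck_path_def)
      then show "\<exists>b'\<ge>b. (a, b') \<in> dyck_path w"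
        using ab \<open>j \<le> ?h\<close> by (intro exI[of _ "real ?h"]) auto
    qed
  qed
  have "interior (unit_square i j) = {real i - 1<..<real i} \<times> {real j - 1<..<real j}"
    by (simp add: unit_square_def interior_Times)
  moreover have "\<dots> \<subseteq> {(a, b). a < b} \<longleftrightarrow> i < j"
  proof
    assume sub: "{real i - 1<..<real i} \<times> {real j - 1<..<real j} \<subseteq> {(a, b). a < b}"
    \<comment> \<open>A point near the lower right corner, close enough that \<open>i < j\<close> follows by integrality.\<close>
    have "(real i - 1/3, real j - 2/3) \<in> {real i - 1<..<real i} \<times> {real j - 1<..<real j}"
      by simp
    then have "real i - 1/3 < real j - 2/3"
      using sub by blast
    then show "i < j" by linarith
  qed auto
  ultimately show ?thesis
    using cover by (auto simp: dyck_squares_def)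
qed

text \<open>
  The path never descends, so a square below it remains below it when moved to the right. This is
  why the larger neighbours of a vertex of the Dyck graph are adjacent to each other.
\<close>

lemma dyck_squares_below:
  assumes "(i, j) \<in> dyck_squares w" "0 < i" "i \<le> a" "a < j" "a \<le> count_list w LD"
  shows "(a, j) \<in> dyck_squares w"
proof -
  obtain u v where uv: "w = u @ LD # v" "count_list u LD = i - 1"
    using split_at_count[of i w LD] assms by auto
  obtain u' v' where uv': "w = u' @ LD # v'" "count_list u' LD = a - 1"
    using split_at_count[of a w LD] assms by auto
  have "length u \<le> length u'"
  proof (rule ccontr)
    assume "\<not> length u \<le> length u'"
    then have "count_list (take (Suc (length u')) w) LD \<le> count_list (take (length u) w) LD"
      by (intro count_list_take_mono) simp
    moreover have "take (length u) w = u"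
      using uv(1) by simp
    moreover have "take (Suc (length u')) w = u' @ [LD]"
      using uv'(1) by simp
    ultimately show False
      using uv(2) uv'(2) assms by simp
  qed
  then have "count_list (take (length u) w) LX \<le> count_list (take (length u') w) LX"
    by (rule count_list_take_mono)
  moreover have "take (length u) w = u"
    using uv by simp
  moreover have "take (length u') w = u'"
    using uv' by simp
  ultimately show ?thesis
    using assms dyck_squares_iff[OF uv] dyck_squares_iff[OF uv'] by simp
qed

section \<open>Comparing the two recursions\<close>

text \<open>
  The vertex \<open>i\<close> of the Dyck graph belongs to the \<open>i\<close>-th \<open>D\<close>, so the \<open>D\<close>'s of the suffix \<open>v\<close> span
  the vertices listed here. A further \<open>x\<close> leaves both sides unchanged, and a further \<open>D\<close>
  adds a simplicial vertex.
\<close>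

lemma graph_stirling_suffix:
  assumes dyck: "dyck_word w" and w: "w = u @ v"
  shows "int (graph_stirling ({Suc (count_list u LD)..count_list w LX}, snd (dyck_graph w)) k) =
    normal_coeff v k"
  using w
proof (induction v arbitrary: u k)
  case Nil
  then have "u = w"
    by simp
  moreover have "count_list w LX = count_list w LD"
    using dyck by (simp add: dyck_word_def)
  ultimately have empty: "{Suc (count_list u LD)..count_list w LX} = {}"
    by simp
  show ?case
    unfolding empty graph_stirling_empty by simp
next
  case (Cons a v)
  let ?n = "count_list w LX" and ?E = "snd (dyck_graph w)"
  have IH: "int (graph_stirling ({Suc (count_list (u @ [a]) LD)..?n}, ?E) k) = normal_coeff v k" for k
    using Cons.prems by (intro Cons.IH) simp
  show ?case
  proof (cases a)
    case LX
    then show ?thesis using IH by simp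
  next
    case LD
    define i where "i = Suc (count_list u LD)"
    define h where "h = count_list u LX"
    let ?V = "{Suc i..?n}"
    have balance: "count_list w LD = ?n"
      using dyck by (simp add: dyck_word_def)
    \<comment> \<open>The Dyck condition just after the \<open>i\<close>-th \<open>D\<close>; thanks to it \<open>{i<..h}\<close> has \<open>h - i\<close> elements
      without truncation.\<close>
    have prefix: "i \<le> h"
    proof -
      have "take (Suc (length u)) w = u @ [LD]" "Suc (length u) \<le> length w"
        using Cons.prems LD by auto
      moreover have "count_list (take (Suc (length u)) w) LD \<le> count_list (take (Suc (length u)) w) LX"
        using dyck \<open>Suc (length u) \<le> length w\<close> by (simp only: dyck_word_def)
      ultimately show ?thesis
        by (simp add: i_def h_def)
    qed
    have n: "?n = h + count_list v LX" "?n = i + count_list v LD"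
      using Cons.prems LD balance by (auto simp: h_def i_def)
    have E: "{a, b} \<in> ?E \<longleftrightarrow> a \<in> {1..?n} \<and> b \<in> {1..?n} \<and> (a, b) \<in> dyck_squares w"
      if "a < b" for a b
      using that unfolding dyck_graph_def Let_def snd_conv mem_Collect_eq doubleton_eq_iff
      by (metis order_less_asym)
    have square: "(i, j) \<in> dyck_squares w \<longleftrightarrow> i < j \<and> j \<le> h" for j
      unfolding h_def using Cons.prems LD by (intro dyck_squares_iff) (auto simp: i_def)
    have N: "{i<..h} = {b \<in> ?V. {b, i} \<in> ?E}"
    proof -
      have "{b, i} \<in> ?E \<longleftrightarrow> b \<le> h" if "i < b" "b \<le> ?n" for b
        using E[of i b] square[of b] that by (auto simp: insert_commute i_def)
      then show ?thesis
        using n by auto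
    qed
    have lt_clique: "{a, b} \<in> ?E" if "a \<in> {i<..h}" "b \<in> {i<..h}" "a < b" for a b
    proof -
      have "b \<le> ?n" "0 < i"
        using that n(1) by (simp_all add: i_def)
      moreover have "(i, b) \<in> dyck_squares w"
        using that square[of b] by simp
      ultimately have "(a, b) \<in> dyck_squares w"
        using that by (intro dyck_squares_below[of i b w a]) (simp_all add: balance)
      then show ?thesis
        using that E[of a b] \<open>b \<le> ?n\<close> by simp
    qed
    have clique: "{a, b} \<in> ?E" if "a \<in> {i<..h}" "b \<in> {i<..h}" "a \<noteq> b" for a b
      using that lt_clique[of a b] lt_clique[of b a] by (cases "a < b") (auto simp: insert_commute)
    have edges: "\<exists>a b. a \<noteq> b \<and> e = {a, b}" if e: "e \<in> ?E" for e
    proof -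
      obtain a b where "a < b" "e = {a, b}"
        using e unfolding dyck_graph_def Let_def snd_conv mem_Collect_eq by blast
      then have "a \<noteq> b \<and> e = {a, b}"
        by simp
      then show ?thesis
        by blast
    qed
    have "int (graph_stirling (insert i ?V, ?E) k) =
        (int k - int (card {i<..h})) * int (graph_stirling (?V, ?E) k) +
        (if k = 0 then 0 else int (graph_stirling (?V, ?E) (k - 1)))"
      by (rule graph_stirling_simplicial_vertex[OF _ _ edges N clique]) auto
    moreover have "insert i ?V = {Suc (count_list u LD)..?n}"
      using n by (auto simp: i_def)
    moreover have "int (graph_stirling (?V, ?E) k) = normal_coeff v k" for k
      using IH[of k] LD by (simp add: i_def)
    \<comment> \<open>As \<open>w\<close> is balanced, the surplus of \<open>x\<close>'s up to the \<open>i\<close>-th \<open>D\<close> is the deficit of \<open>v\<close>.\<close>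
    moreover have "int k - int (card {i<..h}) = int k + excess v"
      using n prefix by (simp add: excess_def)
    ultimately show ?thesis
      using LD by simp
  qed
qed

theorem theorem2p8:
  fixes w :: word and k :: nat
  assumes "dyck_word w"
  shows "word_stirling w k = int (graph_stirling (dyck_graph w) k)"
proof -
  have "dyck_graph w = ({Suc (count_list [] LD)..count_list w LX}, snd (dyck_graph w))"
    by (simp add: dyck_graph_def Let_def)
  then show ?thesis
    using graph_stirling_suffix[OF assms, of "[]" w k] by (simp add: word_stirling_eq_normal_coeff)
qed

end
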